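(* Let $R$ be a reduced commutative ring with identity and $\mathcal{M}$ its space of minimal prime ideals. Every intersection of essential minimal prime ideals of $R$ is an essential ideal if and only if the set of isolated points of $\mathcal{M}$ is dense in $\mathcal{M}$.
   Context: $\mathcal{M}$ is the set of minimal prime ideals of $R$ with the Zariski topology, whose base of open sets is $\{D(a): a\in R\}$, where $D(a)=\{P\in\mathcal{M}: a\notin P\}$. A nonzero ideal is essential if it intersects every nonzero ideal nontrivially; an essential minimal prime ideal is a minimal prime ideal which is essential. "Every intersection" means the intersection of any family of essential minimal prime ideals. *)

theory Defs
  imports "HOL-Algebra.Ideal" "HOL-Analysis.Analysis"
begin

definition reduced_ring :: "('a, 'b) ring_scheme \<Rightarrow> bool" where
  "reduced_ring R \<longleftrightarrow>
     (\<forall>x \<in> carrier R. \<forall>n::nat. x [^]\<^bsub>R\<^esub> n = \<zero>\<^bsub>R\<^esub> \<longrightarrow> x = \<zero>\<^bsub>R\<^esub>)"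

definition minimal_primes :: "('a, 'b) ring_scheme \<Rightarrow> 'a set set" where
  "minimal_primes R =
     {P. primeideal P R \<and> (\<forall>Q. primeideal Q R \<and> Q \<subseteq> P \<longrightarrow> Q = P)}"

definition essential_ideal :: "'a set \<Rightarrow> ('a, 'b) ring_scheme \<Rightarrow> bool" where
  "essential_ideal I R \<longleftrightarrow>
     ideal I R \<and> I \<noteq> {\<zero>\<^bsub>R\<^esub>} \<and>
     (\<forall>J. ideal J R \<and> J \<noteq> {\<zero>\<^bsub>R\<^esub>} \<longrightarrow> I \<inter> J \<noteq> {\<zero>\<^bsub>R\<^esub>})"

definition essential_minimal_primes :: "('a, 'b) ring_scheme \<Rightarrow> 'a set set" where
  "essential_minimal_primes R = {P \<in> minimal_primes R. essential_ideal P R}"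

definition basic_open :: "('a, 'b) ring_scheme \<Rightarrow> 'a \<Rightarrow> 'a set set" where
  "basic_open R a = {P \<in> minimal_primes R. a \<notin> P}"

definition min_spec :: "('a, 'b) ring_scheme \<Rightarrow> 'a set topology" where
  "min_spec R = topology_generated_by (basic_open R ` carrier R)"

definition isolated_points :: "'x topology \<Rightarrow> 'x set" where
  "isolated_points T = {x \<in> topspace T. openin T {x}}"

lemma basic_open_one: "basic_open R \<one>\<^bsub>R\<^esub> = minimal_primes R"
proof -
  have "\<one>\<^bsub>R\<^esub> \<notin> P" if "P \<in> minimal_primes R" for P
    using that ideal.one_imp_carrier[of P R] primeideal.I_notcarr[of P R]
    by (auto simp: minimal_primes_def primeideal_def)
  then show ?thesis
    by (auto simp: basic_open_def)
qed

lemma basic_open_mult: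
  assumes "a \<in> carrier R" "b \<in> carrier R"
  shows "basic_open R (a \<otimes>\<^bsub>R\<^esub> b) = basic_open R a \<inter> basic_open R b"
proof -
  have "a \<otimes>\<^bsub>R\<^esub> b \<in> P \<longleftrightarrow> a \<in> P \<or> b \<in> P" if "P \<in> minimal_primes R" for P
  proof -
    have "primeideal P R" using that by (simp add: minimal_primes_def)
    then interpret primeideal P R .
    show ?thesis
      using I_prime[OF assms] I_r_closed[of a b] I_l_closed[of b a] assms by auto
  qed
  then show ?thesis by (auto simp: basic_open_def)
qed

lemma topspace_min_spec:
  assumes "cring R"
  shows "topspace (min_spec R) = minimal_primes R"
proof -
  interpret cring R by fact
  have "basic_open R a \<subseteq> minimal_primes R" for a
    by (auto simp: basic_open_def)
  moreover have "minimal_primes R \<subseteq> \<Union>(basic_open R ` carrier R)"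
    using UN_upper[OF one_closed, of "basic_open R"] by (simp add: basic_open_one)
  ultimately show ?thesis
    unfolding min_spec_def topology_generated_by_topspace
    by (intro equalityI UN_least)
qed

text \<open>The sets \<open>basic_open R a\<close> are a base, not just a subbase, of \<open>min_spec R\<close>.\<close>

lemma openin_min_spec:
  assumes "cring R"
  shows "openin (min_spec R) U \<longleftrightarrow>
    (\<exists>A \<subseteq> carrier R. U = (\<Union>a\<in>A. basic_open R a))"
proof
  interpret cring R by fact
  assume "openin (min_spec R) U"
  then have "generate_topology_on (basic_open R ` carrier R) U"
    by (simp add: min_spec_def openin_topology_generated_by_iff)
  then show "\<exists>A \<subseteq> carrier R. U = (\<Union>a\<in>A. basic_open R a)"
  proof (induction rule: generate_topology_on.induct)
    case Empty
    then show ?case by (intro exI[of _ "{}"]) auto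
  next
    case (Int S T)
    then obtain A B where AB: "A \<subseteq> carrier R" "B \<subseteq> carrier R"
      "S = (\<Union>a\<in>A. basic_open R a)" "T = (\<Union>a\<in>B. basic_open R a)" by blast
    let ?C = "(\<lambda>(a, b). a \<otimes>\<^bsub>R\<^esub> b) ` (A \<times> B)"
    have "S \<inter> T = (\<Union>(a, b)\<in>A \<times> B. basic_open R a \<inter> basic_open R b)"
      using AB by auto
    also have "\<dots> = (\<Union>(a, b)\<in>A \<times> B. basic_open R (a \<otimes>\<^bsub>R\<^esub> b))"
      using AB basic_open_mult[of _ R] by (intro SUP_cong) (auto simp: subset_iff)
    also have "\<dots> = (\<Union>c\<in>?C. basic_open R c)" by auto
    finally have "S \<inter> T = (\<Union>c\<in>?C. basic_open R c)" .
    moreover have "?C \<subseteq> carrier R" using AB by auto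
    ultimately show ?case by blast
  next
    case (UN K)
    then have "\<forall>k\<in>K. \<exists>A. A \<subseteq> carrier R \<and> k = (\<Union>a\<in>A. basic_open R a)" by blast
    from bchoice[OF this] obtain A where
      A: "\<forall>k\<in>K. A k \<subseteq> carrier R \<and> k = (\<Union>a\<in>A k. basic_open R a)" by blast
    then have "\<Union>K = (\<Union>k\<in>K. \<Union>a\<in>A k. basic_open R a)"
      by (intro arg_cong[where f = Union]) force
    also have "\<dots> = (\<Union>a\<in>(\<Union>k\<in>K. A k). basic_open R a)" by blast
    finally have "\<Union>K = (\<Union>a\<in>(\<Union>k\<in>K. A k). basic_open R a)" .
    moreover have "(\<Union>k\<in>K. A k) \<subseteq> carrier R" using A by blast
    ultimately show ?case by blast
  next
    case (Basis s)
    then obtain a where "a \<in> carrier R" "s = basic_open R a" by auto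
    then show ?case by (intro exI[of _ "{a}"]) auto
  qed
next
  assume "\<exists>A \<subseteq> carrier R. U = (\<Union>a\<in>A. basic_open R a)"
  then obtain A where "A \<subseteq> carrier R" "U = (\<Union>a\<in>A. basic_open R a)" by blast
  moreover have "openin (min_spec R) (basic_open R a)" if "a \<in> carrier R" for a
    using that by (auto simp: min_spec_def openin_topology_generated_by_iff
        intro: generate_topology_on.Basis)
  ultimately show "openin (min_spec R) U" by (simp add: openin_clauses(3) subset_iff)
qed

text \<open>Intersections are taken over nonempty families, as \<open>\<Inter>{} = UNIV\<close> is not the empty
  intersection inside \<open>R\<close>.  That intersection is \<open>carrier R\<close>, which is essential
  by the following lemma whenever \<open>R\<close> is nontrivial; in the zero ring, which has no
  minimal primes, it is the zero ideal.\<close>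

lemma essential_ideal_carrier:
  assumes "cring R" "\<one>\<^bsub>R\<^esub> \<noteq> \<zero>\<^bsub>R\<^esub>"
  shows "essential_ideal (carrier R) R"
proof -
  interpret cring R by fact
  have "carrier R \<inter> J = J" if "ideal J R" for J
    using additive_subgroup.a_subset[OF ideal.axioms(1)[OF that]] by blast
  then show ?thesis
    using oneideal assms(2) one_closed unfolding essential_ideal_def by force
qed

end

theory Submission
  imports Defs
begin

text \<open>
  Everything rests on a dictionary between points and ideals: a minimal prime \<open>P\<close> of a
  reduced ring is \<^emph>\<open>isolated\<close> in the space of minimal primes exactly when it is \<^emph>\<open>not\<close>
  essential (\<open>isolated_points_min_spec\<close>).  The link is an element \<open>a \<notin> P\<close> that annihilates
  \<open>P\<close>.  A prime that avoids \<open>a\<close> must then contain \<open>P\<close>, so \<open>P\<close> is the only point of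
  \<open>basic_open R a\<close>; and the principal ideal of \<open>a\<close> meets \<open>P\<close> only in zero.

  Suppose now that the isolated points are dense, and let \<open>I\<close> be an intersection of essential
  minimal primes.  A nonzero element \<open>a\<close> of an ideal \<open>J\<close> has a nonempty basic open set, which
  contains some isolated point \<open>P\<close>, with \<open>basic_open R b = {P}\<close> say.  All non-isolated primes
  contain \<open>b\<close>, so \<open>a b\<close> lies in \<open>I \<inter> J\<close>, and it is nonzero because it avoids \<open>P\<close>.
  Conversely, if a nonempty \<open>basic_open R a\<close> has no isolated point, then its members are
  essential minimal primes, and their intersection meets the principal ideal of \<open>a\<close> in the
  intersection of all minimal primes, which is zero.

  Both directions use that the minimal primes of a reduced ring intersect in zero, that is,
  that \<open>basic_open R a\<close> is nonempty for \<open>a \<noteq> \<zero>\<close> (\<open>minimal_prime_avoiding\<close>).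
\<close>

section \<open>Minimal primes avoiding a nonzero element\<close>

context cring
begin

text \<open>
  Zorn's lemma applies to the multiplicative sets that contain \<open>a\<close> and avoid zero: the powers
  of \<open>a\<close> form one, since \<open>a\<close> is not nilpotent, and unions of chains are again such sets.
\<close>

lemma maximal_multiplicative_set_exists:
  assumes red: "reduced_ring R" and a: "a \<in> carrier R" "a \<noteq> \<zero>"
  obtains S where "submonoid S R" "a \<in> S" "\<zero> \<notin> S"
    and "\<And>T. submonoid T R \<Longrightarrow> \<zero> \<notin> T \<Longrightarrow> S \<subseteq> T \<Longrightarrow> T = S"
proof -
  define \<A> where "\<A> = {S. submonoid S R \<and> a \<in> S \<and> \<zero> \<notin> S}"
  have "range (\<lambda>n::nat. a [^] n) \<in> \<A>"
  proof -
    have "submonoid (range (\<lambda>n::nat. a [^] n)) R"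
    proof
      show "\<one> \<in> range (\<lambda>n::nat. a [^] n)" by (rule range_eqI[of _ _ 0]) simp
      show "range (\<lambda>n::nat. a [^] n) \<subseteq> carrier R" using a by auto
      fix x y assume "x \<in> range (\<lambda>n::nat. a [^] n)" "y \<in> range (\<lambda>n::nat. a [^] n)"
      then obtain m n where "x = a [^] (m::nat)" "y = a [^] (n::nat)" by blast
      then show "x \<otimes> y \<in> range (\<lambda>n::nat. a [^] n)"
        using a by (intro range_eqI[of _ _ "m + n"]) (simp add: nat_pow_mult)
    qed
    moreover have "a \<in> range (\<lambda>n::nat. a [^] n)"
      using a by (intro range_eqI[of _ _ 1]) simp
    moreover have "\<zero> \<notin> range (\<lambda>n::nat. a [^] n)"
    proof
      assume "\<zero> \<in> range (\<lambda>n::nat. a [^] n)"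
      then obtain n where "a [^] (n::nat) = \<zero>" by (metis rangeE)
      then show False using red a unfolding reduced_ring_def by blast
    qed
    ultimately show ?thesis by (simp add: \<A>_def)
  qed
  moreover have "\<Union>\<C> \<in> \<A>" if "\<C> \<noteq> {}" and "subset.chain \<A> \<C>" for \<C>
  proof -
    have sub: "submonoid S R" "a \<in> S" "\<zero> \<notin> S" if "S \<in> \<C>" for S
      using \<open>subset.chain \<A> \<C>\<close> that by (auto simp: \<A>_def subset_chain_def)
    have "submonoid (\<Union>\<C>) R"
    proof
      show "\<Union>\<C> \<subseteq> carrier R" by (intro Union_least submonoid.subset sub(1))
      obtain S where S: "S \<in> \<C>" using \<open>\<C> \<noteq> {}\<close> by blast
      then show "\<one> \<in> \<Union>\<C>" using submonoid.one_closed[OF sub(1)[OF S]] by (rule UnionI)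
      fix x y assume "x \<in> \<Union>\<C>" "y \<in> \<Union>\<C>"
      then obtain S T where ST: "S \<in> \<C>" "T \<in> \<C>" "x \<in> S" "y \<in> T" by blast
      then consider "S \<subseteq> T" | "T \<subseteq> S"
        using \<open>subset.chain \<A> \<C>\<close> by (auto simp: subset_chain_def)
      then show "x \<otimes> y \<in> \<Union>\<C>"
      proof cases
        case 1
        then have "x \<otimes> y \<in> T" using ST by (intro submonoid.m_closed[OF sub(1)]) auto
        then show ?thesis using ST by blast
      next
        case 2
        then have "x \<otimes> y \<in> S" using ST by (intro submonoid.m_closed[OF sub(1)]) auto
        then show ?thesis using ST by blast
      qed
    qed
    then show ?thesis using sub \<open>\<C> \<noteq> {}\<close> by (auto simp: \<A>_def)
  qed
  ultimately have "\<exists>S\<in>\<A>. \<forall>T\<in>\<A>. S \<subseteq> T \<longrightarrow> T = S"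
    by (intro subset_Zorn_nonempty) auto
  then obtain S where S: "S \<in> \<A>" "\<forall>T\<in>\<A>. S \<subseteq> T \<longrightarrow> T = S" by blast
  show ?thesis
  proof (rule that[of S])
    show "submonoid S R" "a \<in> S" "\<zero> \<notin> S" using S(1) by (simp_all add: \<A>_def)
    fix T assume "submonoid T R" "\<zero> \<notin> T" "S \<subseteq> T"
    then have "T \<in> \<A>" using \<open>a \<in> S\<close> by (auto simp: \<A>_def)
    then show "T = S" using S(2) \<open>S \<subseteq> T\<close> by blast
  qed
qed

text \<open>
  If \<open>x \<notin> S\<close>, then adjoining the powers of \<open>x\<close> to \<open>S\<close> must produce zero, say \<open>s x^n = \<zero>\<close>.
  Then \<open>s x\<close> is nilpotent, hence zero.
\<close>

lemma annihilated_by_maximal_multiplicative_set: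
  assumes red: "reduced_ring R" and S: "submonoid S R"
    and max: "\<And>T. submonoid T R \<Longrightarrow> \<zero> \<notin> T \<Longrightarrow> S \<subseteq> T \<Longrightarrow> T = S"
    and x: "x \<in> carrier R" "x \<notin> S"
  shows "\<exists>s\<in>S. s \<otimes> x = \<zero>"
proof -
  interpret S: submonoid S R by (rule S)
  define T where "T = {s \<otimes> x [^] (n::nat) | s n. s \<in> S}"
  have "submonoid T R"
  proof
    show "T \<subseteq> carrier R" using x S.subset by (auto simp: T_def)
    show "\<one> \<in> T" using S.one_closed
      by (auto simp: T_def intro!: exI[of _ \<one>] exI[of _ "0::nat"])
    fix u v assume "u \<in> T" "v \<in> T"
    then obtain s m t n where st: "s \<in> S" "t \<in> S"
      and uv: "u = s \<otimes> x [^] (m::nat)" "v = t \<otimes> x [^] (n::nat)" by (auto simp: T_def)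
    have car: "s \<in> carrier R" "t \<in> carrier R" using st S.subset by auto
    have "u \<otimes> v = (s \<otimes> t) \<otimes> (x [^] m \<otimes> x [^] n)"
      using car x by (simp add: uv m_ac)
    also have "\<dots> = (s \<otimes> t) \<otimes> x [^] (m + n)" using x by (simp add: nat_pow_mult)
    finally show "u \<otimes> v \<in> T" using st by (auto simp: T_def)
  qed
  moreover have "S \<subseteq> T"
  proof
    fix s assume "s \<in> S"
    moreover from this have "s = s \<otimes> x [^] (0::nat)" using S.subset by auto
    ultimately show "s \<in> T" unfolding T_def by blast
  qed
  moreover have "x \<in> T"
    using x S.one_closed by (auto simp: T_def intro!: exI[of _ \<one>] exI[of _ "1::nat"])
  ultimately have "\<zero> \<in> T" using max x by blast
  then obtain s n where s: "s \<in> S" "s \<otimes> x [^] (n::nat) = \<zero>" by (auto simp: T_def)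
  have car: "s \<in> carrier R" using s S.subset by auto
  \<comment> \<open>The exponent \<open>Suc n\<close> also covers \<open>n = 0\<close>.\<close>
  have "(s \<otimes> x) [^] Suc n = (s [^] n \<otimes> x) \<otimes> (s \<otimes> x [^] n)"
    using car x by (simp add: nat_pow_distrib m_ac)
  also have "\<dots> = \<zero>" using s car x by simp
  finally have "s \<otimes> x = \<zero>" using red car x unfolding reduced_ring_def by blast
  then show ?thesis using s by blast
qed

text \<open>
  The complement of a maximal multiplicative set \<open>S\<close> consists of the elements annihilated by
  some member of \<open>S\<close>.  This description makes it an ideal, and a minimal prime: a prime
  \<open>Q\<close> inside the complement contains \<open>s x = \<zero>\<close> but not \<open>s \<in> S\<close>, hence contains \<open>x\<close>.
\<close>

lemma minimal_prime_avoiding: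
  assumes red: "reduced_ring R" and a: "a \<in> carrier R" "a \<noteq> \<zero>"
  shows "basic_open R a \<noteq> {}"
proof -
  obtain S where S: "submonoid S R" "a \<in> S" "\<zero> \<notin> S"
    and max: "\<And>T. submonoid T R \<Longrightarrow> \<zero> \<notin> T \<Longrightarrow> S \<subseteq> T \<Longrightarrow> T = S"
    using maximal_multiplicative_set_exists[OF red a] by metis
  interpret S: submonoid S R by (rule S)
  define P where "P = carrier R - S"
  have P_iff: "x \<in> P \<longleftrightarrow> (\<exists>s\<in>S. s \<otimes> x = \<zero>)" if "x \<in> carrier R" for x
    using annihilated_by_maximal_multiplicative_set[OF red S(1) max] that S(3) S.m_closed
    unfolding P_def by (metis DiffD2 DiffI)
  have prime: "primeideal P R"
  proof (rule primeidealI)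
    show "ideal P R"
    proof (rule idealI)
      show "ring R" by (rule ring_axioms)
      show "subgroup P (add_monoid R)"
      proof (rule add.subgroupI)
        show "P \<subseteq> carrier R" by (simp add: P_def)
        show "P \<noteq> {}" using S(3) by (auto simp: P_def)
      next
        fix x assume "x \<in> P"
        then obtain s where s: "s \<in> S" "s \<otimes> x = \<zero>" and x: "x \<in> carrier R"
          using P_iff by (auto simp: P_def)
        then have "s \<otimes> (\<ominus> x) = \<zero>" using S.subset r_minus[of s x] by auto
        then show "\<ominus> x \<in> P" using s x P_iff[of "\<ominus> x"] by auto
      next
        fix x y assume "x \<in> P" "y \<in> P"
        then obtain s t where st: "s \<in> S" "s \<otimes> x = \<zero>" "t \<in> S" "t \<otimes> y = \<zero>"
          and xy: "x \<in> carrier R" "y \<in> carrier R"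
          using P_iff by (auto simp: P_def)
        have car: "s \<in> carrier R" "t \<in> carrier R" using st S.subset by auto
        have "(s \<otimes> t) \<otimes> (x \<oplus> y) = t \<otimes> (s \<otimes> x) \<oplus> s \<otimes> (t \<otimes> y)"
          using car xy by (simp add: r_distr m_ac)
        also have "\<dots> = \<zero>" using st car by simp
        finally show "x \<oplus> y \<in> P" using st xy P_iff[of "x \<oplus> y"] S.m_closed by auto
      qed
    next
      fix x r assume "x \<in> P" and r: "r \<in> carrier R"
      then obtain s where s: "s \<in> S" "s \<otimes> x = \<zero>" and x: "x \<in> carrier R"
        using P_iff by (auto simp: P_def)
      have car: "s \<in> carrier R" using s S.subset by auto
      have "s \<otimes> (r \<otimes> x) = r \<otimes> (s \<otimes> x)" using car x r by (simp add: m_ac)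
      then show "r \<otimes> x \<in> P" using s x r P_iff[of "r \<otimes> x"] by auto
      then show "x \<otimes> r \<in> P" using x r by (simp add: m_comm)
    qed
    show "cring R" by (rule cring_axioms)
    show "carrier R \<noteq> P" using S.one_closed one_closed unfolding P_def by blast
    show "x \<in> P \<or> y \<in> P" if "x \<in> carrier R" "y \<in> carrier R" "x \<otimes> y \<in> P" for x y
      using that S.m_closed by (auto simp: P_def)
  qed
  have "Q = P" if Q: "primeideal Q R" "Q \<subseteq> P" for Q
  proof
    interpret Q: primeideal Q R by (rule Q)
    show "P \<subseteq> Q"
    proof
      fix x assume "x \<in> P"
      then obtain s where s: "s \<in> S" "s \<otimes> x = \<zero>" and x: "x \<in> carrier R"
        using P_iff by (auto simp: P_def)
      have "s \<notin> Q" using s(1) Q(2) by (auto simp: P_def)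
      moreover have "s \<otimes> x \<in> Q" using s by simp
      ultimately show "x \<in> Q" using Q.I_prime[of s x] s x S.subset by blast
    qed
  qed (rule Q)
  then have "P \<in> minimal_primes R" using prime unfolding minimal_primes_def by blast
  then show ?thesis using S(2) by (auto simp: basic_open_def P_def)
qed

corollary zero_if_in_all_minimal_primes:
  assumes "reduced_ring R" "x \<in> carrier R" "\<And>P. P \<in> minimal_primes R \<Longrightarrow> x \<in> P"
  shows "x = \<zero>"
  using minimal_prime_avoiding[of x] assms by (auto simp: basic_open_def)

section \<open>Isolated points and essential minimal primes\<close>

lemma openin_basic_open: "a \<in> carrier R \<Longrightarrow> openin (min_spec R) (basic_open R a)"
  using openin_min_spec[OF cring_axioms] by (auto intro!: exI[of _ "{a}"])

lemma isolated_point_iff_basic_open: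
  "P \<in> isolated_points (min_spec R) \<longleftrightarrow> (\<exists>a\<in>carrier R. basic_open R a = {P})"
proof
  assume "P \<in> isolated_points (min_spec R)"
  then have "openin (min_spec R) {P}" by (simp add: isolated_points_def)
  then obtain A where A: "A \<subseteq> carrier R" "{P} = (\<Union>a\<in>A. basic_open R a)"
    using openin_min_spec[OF cring_axioms] by auto
  then obtain a where "a \<in> A" "P \<in> basic_open R a" by blast
  then show "\<exists>a\<in>carrier R. basic_open R a = {P}" using A by blast
next
  assume "\<exists>a\<in>carrier R. basic_open R a = {P}"
  then obtain a where a: "a \<in> carrier R" "basic_open R a = {P}" by blast
  then have "openin (min_spec R) {P}" using openin_basic_open by metis
  then show "P \<in> isolated_points (min_spec R)"
    using openin_subset[of "min_spec R" "{P}"] by (simp add: isolated_points_def)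
qed

text \<open>
  If \<open>P\<close> is the only minimal prime avoiding \<open>a\<close>, then \<open>a x\<close> lies in every minimal prime for
  \<open>x \<in> P\<close>, so \<open>a\<close> annihilates \<open>P\<close>.  In the other direction, every prime avoiding \<open>a\<close> contains
  the annihilated set \<open>P\<close>, and equals \<open>P\<close> if it is minimal.
\<close>

lemma basic_open_singleton_iff:
  assumes red: "reduced_ring R" and P: "P \<in> minimal_primes R" and a: "a \<in> carrier R"
  shows "basic_open R a = {P} \<longleftrightarrow> a \<notin> P \<and> (\<forall>x\<in>P. a \<otimes> x = \<zero>)"
proof -
  have "primeideal P R" using P by (simp add: minimal_primes_def)
  then interpret P: primeideal P R .
  show ?thesis
  proof
    assume D: "basic_open R a = {P}"
    have "a \<otimes> x = \<zero>" if x: "x \<in> P" for x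
    proof (rule zero_if_in_all_minimal_primes[OF red])
      have xc: "x \<in> carrier R" using x P.a_subset by blast
      then show "a \<otimes> x \<in> carrier R" using a by simp
      fix Q assume Q: "Q \<in> minimal_primes R"
      then have "primeideal Q R" by (simp add: minimal_primes_def)
      then interpret Q: primeideal Q R .
      have "a \<in> Q \<or> x \<in> Q" using Q D x unfolding basic_open_def by blast
      then show "a \<otimes> x \<in> Q"
        using Q.I_r_closed[of a x] Q.I_l_closed[of x a] xc a by blast
    qed
    moreover have "a \<notin> P" using D unfolding basic_open_def by blast
    ultimately show "a \<notin> P \<and> (\<forall>x\<in>P. a \<otimes> x = \<zero>)" by blast
  next
    assume ann: "a \<notin> P \<and> (\<forall>x\<in>P. a \<otimes> x = \<zero>)"
    have "Q = P" if Q: "Q \<in> minimal_primes R" "a \<notin> Q" for Q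
    proof -
      have "primeideal Q R" using Q by (simp add: minimal_primes_def)
      then interpret Q: primeideal Q R .
      have "x \<in> Q" if x: "x \<in> P" for x
      proof -
        have "a \<otimes> x \<in> Q" using ann x by simp
        then show ?thesis using Q.I_prime[of a x] a x P.a_subset Q(2) by blast
      qed
      then have "P \<subseteq> Q" by blast
      then show ?thesis using Q(1) P.primeideal_axioms unfolding minimal_primes_def by blast
    qed
    then show "basic_open R a = {P}" using P ann unfolding basic_open_def by blast
  qed
qed

text \<open>
  An annihilator \<open>a \<notin> P\<close> of \<open>P\<close> generates an ideal that meets \<open>P\<close> in zero.  Conversely, a
  nonzero element of an ideal meeting \<open>P\<close> in zero annihilates \<open>P\<close>.  The zero ideal is
  inessential by definition and is annihilated by \<open>\<one>\<close>.
\<close>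

lemma not_essential_iff_annihilator:
  assumes "primeideal P R"
  shows "\<not> essential_ideal P R \<longleftrightarrow> (\<exists>a\<in>carrier R. a \<notin> P \<and> (\<forall>x\<in>P. a \<otimes> x = \<zero>))"
proof -
  interpret P: primeideal P R by fact
  show ?thesis
  proof
    assume "\<not> essential_ideal P R"
    then consider "P = {\<zero>}"
      | J where "ideal J R" "J \<noteq> {\<zero>}" "P \<inter> J = {\<zero>}"
      using P.ideal_axioms by (auto simp: essential_ideal_def)
    then show "\<exists>a\<in>carrier R. a \<notin> P \<and> (\<forall>x\<in>P. a \<otimes> x = \<zero>)"
    proof cases
      case 1
      have "\<one> \<notin> P" using P.I_notcarr P.one_imp_carrier by auto
      then show ?thesis using 1 by (intro bexI[of _ \<one>]) auto
    next
      case 2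
      interpret J: ideal J R by fact
      obtain a where a: "a \<in> J" "a \<noteq> \<zero>" using 2(2) J.zero_closed by blast
      have ac: "a \<in> carrier R" using a J.a_subset by blast
      have "a \<otimes> x = \<zero>" if x: "x \<in> P" for x
      proof -
        have "x \<in> carrier R" using x P.a_subset by blast
        then have "a \<otimes> x \<in> P \<inter> J"
          using x a ac P.I_l_closed[of x a] J.I_r_closed[of a x] by auto
        then show ?thesis using 2(3) by blast
      qed
      moreover have "a \<notin> P" using a 2(3) by blast
      ultimately show ?thesis using ac by blast
    qed
  next
    assume "\<exists>a\<in>carrier R. a \<notin> P \<and> (\<forall>x\<in>P. a \<otimes> x = \<zero>)"
    then obtain a where a: "a \<in> carrier R" "a \<notin> P" "\<forall>x\<in>P. a \<otimes> x = \<zero>" by blast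
    have "P \<inter> PIdl a \<subseteq> {\<zero>}"
    proof
      fix x assume "x \<in> P \<inter> PIdl a"
      then obtain r where r: "r \<in> carrier R" "x = r \<otimes> a" "r \<otimes> a \<in> P"
        by (auto simp: cgenideal_def)
      then have "r \<in> P" using P.I_prime[of r a] a by auto
      then have "a \<otimes> r = \<zero>" using a by blast
      then show "x \<in> {\<zero>}" using r a by (simp add: m_comm)
    qed
    then have "P \<inter> PIdl a = {\<zero>}"
      using additive_subgroup.zero_closed[OF ideal.axioms(1)[OF cgenideal_ideal[OF a(1)]]]
      by auto
    moreover have "PIdl a \<noteq> {\<zero>}" using cgenideal_self[OF a(1)] a(2) by auto
    ultimately show "\<not> essential_ideal P R"
      using cgenideal_ideal[OF a(1)] by (auto simp: essential_ideal_def)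
  qed
qed

theorem isolated_points_min_spec:
  assumes "reduced_ring R"
  shows "isolated_points (min_spec R) = minimal_primes R - essential_minimal_primes R"
proof -
  have "P \<in> isolated_points (min_spec R) \<longleftrightarrow> \<not> essential_ideal P R"
    if P: "P \<in> minimal_primes R" for P
  proof -
    have "primeideal P R" using P by (simp add: minimal_primes_def)
    then show ?thesis
      using basic_open_singleton_iff[OF assms P]
      by (simp add: isolated_point_iff_basic_open not_essential_iff_annihilator)
  qed
  moreover have "isolated_points (min_spec R) \<subseteq> minimal_primes R"
    using topspace_min_spec[OF cring_axioms] by (auto simp: isolated_points_def)
  ultimately show ?thesis by (auto simp: essential_minimal_primes_def)
qed

section \<open>Density of the isolated points\<close>

lemma dense_in_min_spec_iff:
  assumes "reduced_ring R"
  shows "min_spec R closure_of X = topspace (min_spec R) \<longleftrightarrow>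
    (\<forall>a\<in>carrier R. a \<noteq> \<zero> \<longrightarrow> basic_open R a \<inter> X \<noteq> {})"
  unfolding dense_intersects_open
proof (intro iffI ballI allI impI)
  fix a assume "\<forall>U. openin (min_spec R) U \<and> U \<noteq> {} \<longrightarrow> X \<inter> U \<noteq> {}" "a \<in> carrier R" "a \<noteq> \<zero>"
  then show "basic_open R a \<inter> X \<noteq> {}"
    using openin_basic_open[of a] minimal_prime_avoiding[OF assms, of a]
    by (subst Int_commute) simp
next
  fix U assume dense: "\<forall>a\<in>carrier R. a \<noteq> \<zero> \<longrightarrow> basic_open R a \<inter> X \<noteq> {}"
    and U: "openin (min_spec R) U \<and> U \<noteq> {}"
  then obtain A where A: "A \<subseteq> carrier R" "U = (\<Union>a\<in>A. basic_open R a)"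
    using openin_min_spec[OF cring_axioms, of U] by auto
  then obtain a P where a: "a \<in> carrier R" "basic_open R a \<subseteq> U" "P \<in> basic_open R a"
    using U by blast
  have "primeideal P R" using a(3) by (simp add: basic_open_def minimal_primes_def)
  then interpret P: primeideal P R .
  have "a \<noteq> \<zero>" using a(3) P.zero_closed by (auto simp: basic_open_def)
  then have "basic_open R a \<inter> X \<noteq> {}" using dense a(1) by simp
  then show "X \<inter> U \<noteq> {}" using a(2) by blast
qed

lemma Inter_minimal_primes_ideal:
  assumes "F \<subseteq> minimal_primes R" "F \<noteq> {}"
  shows "ideal (\<Inter>F) R"
  using assms by (intro i_Intersect) (auto simp: minimal_primes_def primeideal_def)

lemma essential_Inter_if_isolated_dense:
  assumes red: "reduced_ring R"
    and dense: "\<And>a. a \<in> carrier R \<Longrightarrow> a \<noteq> \<zero>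
      \<Longrightarrow> basic_open R a \<inter> isolated_points (min_spec R) \<noteq> {}"
    and F: "F \<subseteq> essential_minimal_primes R" "F \<noteq> {}"
  shows "essential_ideal (\<Inter>F) R"
proof -
  have FM: "F \<subseteq> minimal_primes R" using F by (auto simp: essential_minimal_primes_def)
  have meets: "\<Inter>F \<inter> J \<noteq> {\<zero>}" if "ideal J R" and "J \<noteq> {\<zero>}" for J
  proof -
    interpret J: ideal J R by fact
    obtain a where a: "a \<in> J" "a \<noteq> \<zero>" using \<open>J \<noteq> {\<zero>}\<close> J.zero_closed by blast
    have ac: "a \<in> carrier R" using a J.a_subset by blast
    obtain P where P: "P \<in> basic_open R a" "P \<in> isolated_points (min_spec R)"
      using dense[OF ac a(2)] by blast
    then obtain b where b: "b \<in> carrier R" "basic_open R b = {P}"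
      by (auto simp: isolated_point_iff_basic_open)
    have "P \<notin> F" using P(2) F(1) isolated_points_min_spec[OF red] by blast
    then have bF: "b \<in> Q" if "Q \<in> F" for Q
      using that FM b(2) by (auto simp: basic_open_def)
    have "a \<otimes> b \<in> \<Inter>F"
      using bF ideal.I_l_closed[OF Inter_minimal_primes_ideal[OF FM F(2)]] ac by blast
    moreover have "a \<otimes> b \<in> J" using J.I_r_closed a b by blast
    moreover have "a \<otimes> b \<noteq> \<zero>"
    proof -
      have "P \<in> basic_open R (a \<otimes> b)" using P b ac by (simp add: basic_open_mult)
      then have "primeideal P R" "a \<otimes> b \<notin> P" by (auto simp: basic_open_def minimal_primes_def)
      then show ?thesis
        using additive_subgroup.zero_closed[OF ideal.axioms(1)[OF primeideal.axioms(1)]]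
        by metis
    qed
    ultimately show ?thesis by blast
  qed
  \<comment> \<open>That the intersection is nonzero is the case \<open>J = carrier R\<close>.\<close>
  have "carrier R \<noteq> {\<zero>}"
  proof -
    obtain P where "primeideal P R" using F(2) FM by (auto simp: minimal_primes_def)
    then interpret P: primeideal P R .
    show ?thesis using P.I_notcarr P.zero_closed P.a_subset by auto
  qed
  then have "\<Inter>F \<noteq> {\<zero>}" using meets[OF oneideal] by auto
  then show ?thesis
    using meets Inter_minimal_primes_ideal[OF FM F(2)] by (auto simp: essential_ideal_def)
qed

text \<open>
  An element of \<open>PIdl a\<close> lies in every prime containing \<open>a\<close>.  If it also lies in every minimal
  prime avoiding \<open>a\<close>, it lies in all minimal primes.
\<close>

lemma Inter_basic_open_Int_PIdl:
  assumes red: "reduced_ring R" and a: "a \<in> carrier R"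
  shows "\<Inter>(basic_open R a) \<inter> PIdl a \<subseteq> {\<zero>}"
proof
  fix x assume "x \<in> \<Inter>(basic_open R a) \<inter> PIdl a"
  then obtain r where r: "r \<in> carrier R" "x = r \<otimes> a"
    and x: "\<And>Q. Q \<in> basic_open R a \<Longrightarrow> x \<in> Q" by (auto simp: cgenideal_def)
  have "x = \<zero>"
  proof (rule zero_if_in_all_minimal_primes[OF red])
    show "x \<in> carrier R" using r a by simp
    fix Q assume Q: "Q \<in> minimal_primes R"
    then have "ideal Q R" by (simp add: minimal_primes_def primeideal_def)
    show "x \<in> Q"
    proof (cases "a \<in> Q")
      case True
      then show ?thesis using ideal.I_l_closed[OF \<open>ideal Q R\<close>] r by simp
    next
      case False
      then show ?thesis using x Q by (simp add: basic_open_def)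
    qed
  qed
  then show "x \<in> {\<zero>}" by simp
qed

lemma isolated_dense_if_essential_Inter:
  assumes red: "reduced_ring R"
    and ess: "\<And>F. F \<subseteq> essential_minimal_primes R \<Longrightarrow> F \<noteq> {} \<Longrightarrow> essential_ideal (\<Inter>F) R"
    and a: "a \<in> carrier R" "a \<noteq> \<zero>"
  shows "basic_open R a \<inter> isolated_points (min_spec R) \<noteq> {}"
proof
  assume "basic_open R a \<inter> isolated_points (min_spec R) = {}"
  then have "basic_open R a \<subseteq> essential_minimal_primes R"
    using isolated_points_min_spec[OF red] by (auto simp: basic_open_def)
  then have E: "essential_ideal (\<Inter>(basic_open R a)) R"
    using ess minimal_prime_avoiding[OF red a] by blast
  interpret E: ideal "\<Inter>(basic_open R a)" R using E unfolding essential_ideal_def by blast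
  interpret I: ideal "PIdl a" R by (rule cgenideal_ideal[OF a(1)])
  have "\<Inter>(basic_open R a) \<inter> PIdl a = {\<zero>}"
    using Inter_basic_open_Int_PIdl[OF red a(1)] E.zero_closed I.zero_closed by blast
  moreover have "PIdl a \<noteq> {\<zero>}" using cgenideal_self[OF a(1)] a(2) by auto
  ultimately show False using E I.ideal_axioms unfolding essential_ideal_def by blast
qed

end

theorem proposition3p3:
  fixes R :: "('a, 'b) ring_scheme"
  assumes "cring R" and "reduced_ring R"
  shows "(\<forall>F. F \<subseteq> essential_minimal_primes R \<and> F \<noteq> {} \<longrightarrow> essential_ideal (\<Inter>F) R)
    \<longleftrightarrow> (min_spec R) closure_of (isolated_points (min_spec R)) = topspace (min_spec R)"
proof -
  interpret cring R by fact
  show ?thesis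
    unfolding dense_in_min_spec_iff[OF assms(2)]
  proof (intro iffI allI impI ballI)
    fix F assume "\<forall>a\<in>carrier R. a \<noteq> \<zero>\<^bsub>R\<^esub> \<longrightarrow>
        basic_open R a \<inter> isolated_points (min_spec R) \<noteq> {}"
      and "F \<subseteq> essential_minimal_primes R \<and> F \<noteq> {}"
    then show "essential_ideal (\<Inter>F) R"
      by (intro essential_Inter_if_isolated_dense[OF assms(2)]) simp_all
  next
    fix a assume "\<forall>F. F \<subseteq> essential_minimal_primes R \<and> F \<noteq> {} \<longrightarrow> essential_ideal (\<Inter>F) R"
      and "a \<in> carrier R" "a \<noteq> \<zero>\<^bsub>R\<^esub>"
    then show "basic_open R a \<inter> isolated_points (min_spec R) \<noteq> {}"
      by (intro isolated_dense_if_essential_Inter[OF assms(2)]) simp_all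
  qed
qed

end
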